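(* The sub-Riemannian nilpotent cases $(2,3)$ ($\alpha=0$ and $\beta=0$), $(2,3,4)$ ($\alpha=1$ and $\beta=0$), and $(2,3,5)$ ($\alpha=1$ and $\beta=1$), i.e. the optimal control problems $$\frac12\int_0^T\left(u_1(t)^2+u_2(t)^2\right)dt\to\min,\qquad \dot q(t)=u_1(t)X_1(q(t))+u_2(t)X_2(q(t)),$$ with $q=(x_1,\dots,x_{3+\alpha+\beta})\in\mathbb{R}^{3+\alpha+\beta}$ and $$X_1=\frac{\partial}{\partial x_1},\qquad X_2=\frac{\partial}{\partial x_2}+x_1\frac{\partial}{\partial x_3}+\frac{\alpha}{2}x_1^2\frac{\partial}{\partial x_4}+\beta x_1x_2\frac{\partial}{\partial x_5}$$ (terms with coefficient $\alpha=0$ or $\beta=0$ being absent), are integrable by quadratures.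
   Context: By the Pontryagin maximum principle, the true Hamiltonian of the problem with parameters $(\alpha,\beta)$ is $$\mathcal{H}_{\alpha,\beta}=\frac12\left[\psi_1^2+\left(\psi_2+x_1\psi_3+\frac{\alpha}{2}x_1^2\psi_4+\beta x_1x_2\psi_5\right)^2\right],$$ where $\psi_i$ is the momentum conjugate to $x_i$; the Hamiltonian equations are $\dot x_i=\partial\mathcal{H}_{\alpha,\beta}/\partial\psi_i$, $\dot\psi_i=-\partial\mathcal{H}_{\alpha,\beta}/\partial x_i$, $1\le i\le 3+\alpha+\beta$. An optimal control problem is called integrable by quadratures if its Hamiltonian equations are integrable by quadratures, i.e. their solutions can be represented by a finite number of algebraic operations, inversions of functions, and calculations of integrals of known functions ("quadratures"). The distribution spanned by $X_1,X_2$ is the nilpotent Heisenberg distribution for $(\alpha,\beta)=(0,0)$, the nilpotent Engel distribution for $(1,0)$, and the Cartan distribution for $(1,1)$. The sub-Riemannian metric is the one for which $X_1,X_2$ are orthonormal. *)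

theory Defs
  imports "HOL-Analysis.Analysis"
begin

text \<open>
  \<open>quadrature_on S f\<close>: on the domain \<open>S\<close>, the function \<open>f\<close> of one real variable is obtained
  from constants and the independent variable by finitely many algebraic operations
  (arithmetic and extraction of roots), substitutions of known functions into known functions,
  inversions of known functions and integrations of known functions.  Algebraic operations must
  make sense on all of \<open>S\<close>; integration and inversion are admitted on intervals only, so that
  an integral is determined up to one additive constant.
\<close>

inductive quadrature_on :: "real set \<Rightarrow> (real \<Rightarrow> real) \<Rightarrow> bool" where
  const: "quadrature_on S (\<lambda>t. c)"
| ident: "quadrature_on S (\<lambda>t. t)"
| add: "quadrature_on S f \<Longrightarrow> quadrature_on S g \<Longrightarrow> quadrature_on S (\<lambda>t. f t + g t)"
| diff: "quadrature_on S f \<Longrightarrow> quadrature_on S g \<Longrightarrow> quadrature_on S (\<lambda>t. f t - g t)"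
| mult: "quadrature_on S f \<Longrightarrow> quadrature_on S g \<Longrightarrow> quadrature_on S (\<lambda>t. f t * g t)"
| divide: "quadrature_on S f \<Longrightarrow> quadrature_on S g \<Longrightarrow> (\<forall>t\<in>S. g t \<noteq> 0)
    \<Longrightarrow> quadrature_on S (\<lambda>t. f t / g t)"
| root: "quadrature_on S f \<Longrightarrow> n > 0 \<Longrightarrow> odd n \<or> (\<forall>t\<in>S. f t \<ge> 0)
    \<Longrightarrow> quadrature_on S (\<lambda>t. root n (f t))"
| subst: "quadrature_on S g \<Longrightarrow> quadrature_on U f \<Longrightarrow> g ` S \<subseteq> U
    \<Longrightarrow> quadrature_on S (\<lambda>t. f (g t))"
| inverse: "quadrature_on S f \<Longrightarrow> is_interval S \<Longrightarrow> inj_on f S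
    \<Longrightarrow> quadrature_on (f ` S) (inv_into S f)"
| integral: "quadrature_on S f \<Longrightarrow> is_interval S
    \<Longrightarrow> (\<forall>a\<in>S. \<forall>b\<in>S. a \<le> b \<longrightarrow> (f has_integral (F b - F a)) {a..b})
    \<Longrightarrow> quadrature_on S F"
| cong: "quadrature_on S f \<Longrightarrow> (\<forall>t\<in>S. g t = f t) \<Longrightarrow> quadrature_on S g"

text \<open>
  Points and covectors of \<open>\<real>\<^sup>n\<close> are functions on \<open>nat\<close> of which only the components with
  indices in \<open>{1..n}\<close> are used.
\<close>

type_synonym point = "nat \<Rightarrow> real"

text \<open>The problem of minimising \<open>\<integral>\<^sub>0\<^sup>T running_cost q u dt\<close> subject to \<open>q' = velocity q u\<close>
  with \<open>T = horizon\<close> and controls \<open>u \<in> \<real>\<^sup>2\<close>.\<close>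

record control_problem =
  dimension :: nat
  horizon :: real
  velocity :: "point \<Rightarrow> real \<times> real \<Rightarrow> point"
  running_cost :: "point \<Rightarrow> real \<times> real \<Rightarrow> real"

definition pontryagin_function ::
    "control_problem \<Rightarrow> point \<Rightarrow> point \<Rightarrow> real \<times> real \<Rightarrow> real" where
  "pontryagin_function P x \<psi> u =
     (\<Sum>i=1..dimension P. \<psi> i * velocity P x u i) - running_cost P x u"

text \<open>Maximised Hamiltonian of the maximum principle, normalised by \<open>\<psi>\<^sub>0 = -1\<close>.\<close>

definition true_hamiltonian :: "control_problem \<Rightarrow> point \<Rightarrow> point \<Rightarrow> real" where
  "true_hamiltonian P x \<psi> = (SUP u. pontryagin_function P x \<psi> u)"

definition hamiltonian_solution ::
    "control_problem \<Rightarrow> (real \<Rightarrow> point) \<Rightarrow> (real \<Rightarrow> point) \<Rightarrow> bool" where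
  "hamiltonian_solution P x \<psi> \<longleftrightarrow>
     (\<forall>t\<in>{0..horizon P}. \<forall>i\<in>{1..dimension P}.
        ((\<lambda>s. x s i) has_real_derivative
           deriv (\<lambda>p. true_hamiltonian P (x t) ((\<psi> t)(i := p))) (\<psi> t i))
          (at t within {0..horizon P}) \<and>
        ((\<lambda>s. \<psi> s i) has_real_derivative
           - deriv (\<lambda>y. true_hamiltonian P ((x t)(i := y)) (\<psi> t)) (x t i))
          (at t within {0..horizon P}))"

definition integrable_by_quadratures :: "control_problem \<Rightarrow> bool" where
  "integrable_by_quadratures P \<longleftrightarrow>
     (\<forall>x \<psi>. hamiltonian_solution P x \<psi> \<longrightarrow>
        (\<forall>i\<in>{1..dimension P}.
           quadrature_on {0..horizon P} (\<lambda>t. x t i) \<and>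
           quadrature_on {0..horizon P} (\<lambda>t. \<psi> t i)))"

definition X1 :: "point \<Rightarrow> point" where
  "X1 q = (\<lambda>i. if i = 1 then 1 else 0)"

definition X2 :: "nat \<Rightarrow> nat \<Rightarrow> point \<Rightarrow> point" where
  "X2 \<alpha> \<beta> q = (\<lambda>i. if i = 2 then 1
                  else if i = 3 then q 1
                  else if i = 4 then real \<alpha> / 2 * (q 1)\<^sup>2
                  else if i = 5 then real \<beta> * q 1 * q 2
                  else 0)"

definition sub_riemannian_problem :: "nat \<Rightarrow> nat \<Rightarrow> real \<Rightarrow> control_problem" where
  "sub_riemannian_problem \<alpha> \<beta> T =
     \<lparr>dimension = 3 + \<alpha> + \<beta>,
      horizon = T,
      velocity = (\<lambda>q u i. fst u * X1 q i + snd u * X2 \<alpha> \<beta> q i),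
      running_cost = (\<lambda>q u. ((fst u)\<^sup>2 + (snd u)\<^sup>2) / 2)\<rparr>"

lemma true_hamiltonian_sub_riemannian:
  assumes "(\<alpha>, \<beta>) \<in> {(0, 0), (1, 0), (1, 1)}"
  shows "true_hamiltonian (sub_riemannian_problem \<alpha> \<beta> T) x \<psi> =
    ((\<psi> 1)\<^sup>2 + (\<psi> 2 + x 1 * \<psi> 3 + real \<alpha> / 2 * (x 1)\<^sup>2 * \<psi> 4
       + real \<beta> * x 1 * x 2 * \<psi> 5)\<^sup>2) / 2"
proof -
  define h where "h = \<psi> 2 + x 1 * \<psi> 3 + real \<alpha> / 2 * (x 1)\<^sup>2 * \<psi> 4 + real \<beta> * x 1 * x 2 * \<psi> 5"
  have idx: "{1..3} = {1, 2, 3::nat}" "{1..4} = {1, 2, 3, 4::nat}" "{1..5} = {1, 2, 3, 4, 5::nat}"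
    by auto
  have pf: "pontryagin_function (sub_riemannian_problem \<alpha> \<beta> T) x \<psi> u =
      \<psi> 1 * fst u + h * snd u - ((fst u)\<^sup>2 + (snd u)\<^sup>2) / 2" for u
    using assms unfolding pontryagin_function_def sub_riemannian_problem_def h_def
    by (auto simp: X1_def X2_def idx[simplified] algebra_simps)
  have le: "\<psi> 1 * a + h * b - (a\<^sup>2 + b\<^sup>2) / 2 \<le> ((\<psi> 1)\<^sup>2 + h\<^sup>2) / 2" for a b
    using sum_power2_ge_zero[of "\<psi> 1 - a" "h - b"]
    by (simp add: power2_diff field_simps)
  have "(SUP u. pontryagin_function (sub_riemannian_problem \<alpha> \<beta> T) x \<psi> u) = ((\<psi> 1)\<^sup>2 + h\<^sup>2) / 2"
  proof (rule cSup_eq_maximum)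
    show "((\<psi> 1)\<^sup>2 + h\<^sup>2) / 2 \<in> range (pontryagin_function (sub_riemannian_problem \<alpha> \<beta> T) x \<psi>)"
      by (rule image_eqI[where x = "(\<psi> 1, h)"]) (simp_all add: pf power2_eq_square field_simps)
  next
    fix y assume "y \<in> range (pontryagin_function (sub_riemannian_problem \<alpha> \<beta> T) x \<psi>)"
    then obtain u where "y = pontryagin_function (sub_riemannian_problem \<alpha> \<beta> T) x \<psi> u" by blast
    then show "y \<le> ((\<psi> 1)\<^sup>2 + h\<^sup>2) / 2" using le unfolding pf by blast
  qed
  then show ?thesis
    by (simp add: true_hamiltonian_def h_def)
qed

end

theory Submission
  imports Defs
begin

text \<open>
  In the coordinates \<open>h1 = \<psi> 1\<close>, \<open>h2 = \<psi> 2 + x 1 * \<psi> 3 + \<dots>\<close> (the momenta of the fields \<open>X1\<close>,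
  \<open>X2\<close>) and \<open>h3 = \<psi> 3 + \<alpha> * x 1 * \<psi> 4 + \<beta> * x 2 * \<psi> 5\<close> (the momentum of their bracket) the
  vertical part of the Hamiltonian system separates:
  \<open>h1' = - h2 * h3\<close>, \<open>h2' = h1 * h3\<close>, \<open>h3' = a * h1 + b * h2\<close> with constants \<open>a = \<alpha> * \<psi> 4\<close>,
  \<open>b = \<beta> * \<psi> 5\<close>.  Once \<open>h1\<close> and \<open>h2\<close> are known, the \<open>x i\<close> and \<open>\<psi> i\<close> are iterated
  integrals.

  The vertical system is a pendulum.  Its integrals \<open>h1\<^sup>2 + h2\<^sup>2\<close> and \<open>h3\<^sup>2 / 2 + b * h1 - a * h2\<close>
  turn it into a one-dimensional Newton equation with a polynomial energy law
  \<open>y'\<^sup>2 = p y\<close>, \<open>y'' = p' y / 2\<close>: the unknown is \<open>y = h3\<close> with a quartic \<open>p\<close>, or, when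
  \<open>a = b = 0\<close>, \<open>y = h1\<close> with a quadratic \<open>p\<close> (lemma \<open>quadrature_on_pendulum\<close>).

  A Newton equation is solved by \<open>t = \<integral> dy / sqrt (p y)\<close> and inversion as long as
  \<open>y' \<noteq> 0\<close>.  A turning point makes this integrand singular.  There the velocity \<open>z = y'\<close> is the
  good coordinate: \<open>p\<close> is locally invertible, so \<open>y = p\<^sup>-\<^sup>1 (z\<^sup>2)\<close>, and \<open>z\<close> solves the
  autonomous equation \<open>z' = p' (p\<^sup>-\<^sup>1 (z\<^sup>2)) / 2\<close> with nonvanishing right-hand side.  If neither
  case applies at some time, the solution is an equilibrium, hence constant.  The local
  representations are glued along the compact time interval; gluing needs no case distinction in
  the class of functions, because \<open>min\<close> and \<open>max\<close> are expressible by \<open>sqrt (t\<^sup>2)\<close>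
  (lemmas \<open>quadrature_on_autonomous\<close>, \<open>quadrature_on_glue\<close>, \<open>quadrature_on_newton\<close>).
\<close>

section \<open>Closure properties of functions obtained by quadratures\<close>

lemma quadrature_on_subset:
  assumes "quadrature_on U f" "S \<subseteq> U"
  shows "quadrature_on S f"
  using quadrature_on.subst[OF quadrature_on.ident[of S] assms(1)] assms(2) by simp

lemma quadrature_on_uminus:
  assumes "quadrature_on S f"
  shows "quadrature_on S (\<lambda>t. - f t)"
  using quadrature_on.diff[OF quadrature_on.const[of S 0] assms] by simp

lemma quadrature_on_power:
  assumes "quadrature_on S f"
  shows "quadrature_on S (\<lambda>t. f t ^ n)"
  by (induction n) (auto intro: quadrature_on.const quadrature_on.mult assms)

lemma quadrature_on_poly: "quadrature_on S (poly p)"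
proof (induction p)
  case 0
  show ?case using quadrature_on.const[of S 0] by (simp add: poly_0)
next
  case (pCons c p)
  then have "quadrature_on S (\<lambda>t. c + t * poly p t)"
    by (intro quadrature_on.add quadrature_on.mult quadrature_on.const quadrature_on.ident)
  then show ?case by (rule quadrature_on.cong) simp
qed

lemma quadrature_on_abs:
  assumes "quadrature_on S f"
  shows "quadrature_on S (\<lambda>t. \<bar>f t\<bar>)"
proof -
  have "quadrature_on S (\<lambda>t. root 2 ((f t)\<^sup>2))"
    by (intro quadrature_on.root quadrature_on_power assms) auto
  then show ?thesis
    by (rule quadrature_on.cong) (simp flip: sqrt_def)
qed

text \<open>
  Since \<open>min\<close> and \<open>max\<close> are algebraic in \<open>t\<close> and \<open>\<bar>t - c\<bar>\<close>, the glued function is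
  \<open>f (min t c) + f (max t c) - f c\<close>, where each summand only evaluates \<open>f\<close> on one side of \<open>c\<close>.
\<close>

lemma quadrature_on_glue:
  assumes f: "quadrature_on {a..c} f" "quadrature_on {c..b} f" and c: "a \<le> c" "c \<le> b"
  shows "quadrature_on {a..b} f"
proof -
  have abs: "quadrature_on {a..b} (\<lambda>t. \<bar>t - c\<bar>)"
    by (intro quadrature_on_abs quadrature_on.diff quadrature_on.const quadrature_on.ident)
  have "quadrature_on {a..b} (\<lambda>t. (t + c - \<bar>t - c\<bar>) / 2)"
    by (intro quadrature_on.add quadrature_on.diff quadrature_on.divide quadrature_on.const
        quadrature_on.ident abs) auto
  then have "quadrature_on {a..b} (\<lambda>t. min t c)"
    by (rule quadrature_on.cong) (auto simp: min_def)
  then have fmin: "quadrature_on {a..b} (\<lambda>t. f (min t c))"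
    by (rule quadrature_on.subst[OF _ f(1)]) (use c in auto)
  have "quadrature_on {a..b} (\<lambda>t. (t + c + \<bar>t - c\<bar>) / 2)"
    by (intro quadrature_on.add quadrature_on.diff quadrature_on.divide quadrature_on.const
        quadrature_on.ident abs) auto
  then have "quadrature_on {a..b} (\<lambda>t. max t c)"
    by (rule quadrature_on.cong) (auto simp: max_def)
  then have fmax: "quadrature_on {a..b} (\<lambda>t. f (max t c))"
    by (rule quadrature_on.subst[OF _ f(2)]) (use c in auto)
  have "quadrature_on {a..b} (\<lambda>t. f (min t c) + f (max t c) - f c)"
    by (intro quadrature_on.add quadrature_on.diff quadrature_on.const fmin fmax)
  then show ?thesis
    by (rule quadrature_on.cong) (auto simp: min_def max_def)
qed

lemma quadrature_on_antiderivative: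
  assumes "quadrature_on S f" "is_interval S"
    and F: "\<And>t. t \<in> S \<Longrightarrow> (F has_real_derivative f t) (at t within S)"
  shows "quadrature_on S F"
proof (rule quadrature_on.integral[OF assms(1,2)], intro ballI impI)
  fix a b :: real
  assume ab: "a \<in> S" "b \<in> S" "a \<le> b"
  have "{a..b} \<subseteq> S"
    using ab assms(2) by (meson atLeastAtMost_iff is_interval_1 subsetI)
  then have "(F has_vector_derivative f t) (at t within {a..b})" if "t \<in> {a..b}" for t
    using F that by (meson has_field_derivative_subset
        has_real_derivative_iff_has_vector_derivative subsetD)
  then show "(f has_integral (F b - F a)) {a..b}"
    by (rule fundamental_theorem_of_calculus[OF ab(3)])
qed

section \<open>Autonomous equations of first order\<close>

lemma inj_on_if_deriv_nonzero:
  fixes f :: "real \<Rightarrow> real"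
  assumes S: "is_interval S"
    and f: "\<And>t. t \<in> S \<Longrightarrow> (f has_real_derivative f' t) (at t within S)"
    and nz: "\<And>t. t \<in> S \<Longrightarrow> f' t \<noteq> 0"
  shows "inj_on f S"
proof (rule linorder_inj_onI)
  fix s t
  assume st: "s < t" "s \<in> S" "t \<in> S"
  have sub: "{s..t} \<subseteq> S"
    using st S by (meson atLeastAtMost_iff is_interval_1 subsetI)
  have "\<exists>x\<in>{s<..<t}. f t - f s = (\<lambda>h. f' x * h) (t - s)"
  proof (rule mvt_simple[OF st(1)])
    fix x assume "s \<le> x" "x \<le> t"
    then have "(f has_real_derivative f' x) (at x within {s..t})"
      using sub f has_field_derivative_subset by (meson atLeastAtMost_iff subsetD)
    then show "(f has_derivative (\<lambda>h. f' x * h)) (at x within {s..t})"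
      by (simp add: has_field_derivative_def)
  qed
  then obtain x where "x \<in> {s<..<t}" "f t - f s = f' x * (t - s)"
    by blast
  moreover from this have "f' x \<noteq> 0"
    using sub by (intro nz) auto
  ultimately show "f s \<noteq> f t"
    using st(1) by auto
qed (use S in auto)

text \<open>
  Separation of variables: the inverse function \<open>\<tau>\<close> of \<open>f\<close> satisfies \<open>\<tau>' = 1 / g\<close>, so \<open>\<tau>\<close> is an
  integral of a known function and \<open>f\<close> is the inversion of \<open>\<tau>\<close>.
\<close>

lemma quadrature_on_autonomous:
  assumes f: "\<And>t. t \<in> {a..b} \<Longrightarrow> (f has_real_derivative g (f t)) (at t within {a..b})"
    and g: "quadrature_on (f ` {a..b}) g"
    and nz: "\<And>t. t \<in> {a..b} \<Longrightarrow> g (f t) \<noteq> 0"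
  shows "quadrature_on {a..b} f"
proof -
  define J where "J = f ` {a..b}"
  define \<tau> where "\<tau> = inv_into {a..b} f"
  have inj: "inj_on f {a..b}"
    by (rule inj_on_if_deriv_nonzero[OF _ f nz]) (simp add: is_interval_cc)
  have cont: "continuous_on {a..b} f"
    using f by (meson DERIV_continuous continuous_on_eq_continuous_within)
  have J: "is_interval J"
    unfolding J_def is_interval_connected_1
    by (intro connected_continuous_image cont) simp
  have \<tau>f: "\<tau> (f t) = t" if "t \<in> {a..b}" for t
    using that inj by (simp add: \<tau>_def)
  have \<tau>J: "\<tau> ` J = {a..b}"
    using inj by (simp add: \<tau>_def J_def)
  have cont_\<tau>: "continuous_on J \<tau>"
    unfolding J_def by (rule continuous_on_inv[OF cont]) (auto simp: \<tau>f)
  have deriv_\<tau>: "(\<tau> has_real_derivative 1 / g y) (at y within J)" if y: "y \<in> J" for y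
  proof -
    obtain t where t: "t \<in> {a..b}" "y = f t"
      using y unfolding J_def by blast
    have "(\<tau> has_derivative (\<lambda>h. 1 / g (f t) * h)) (at (f t) within f ` {a..b})"
    proof (rule has_derivative_inverse_within)
      show "(f has_derivative (\<lambda>h. g (f t) * h)) (at t within {a..b})"
        using f[OF t(1)] unfolding has_field_derivative_def .
      show "continuous (at (f t) within f ` {a..b}) \<tau>"
        using cont_\<tau> t by (auto simp: J_def continuous_on_eq_continuous_within)
      show "(\<lambda>h. 1 / g (f t) * h) \<circ> (\<lambda>h. g (f t) * h) = id"
        using nz[OF t(1)] by (auto simp: fun_eq_iff)
      show "linear (\<lambda>h. 1 / g (f t) * h)"
        by (rule bounded_linear.linear[OF bounded_linear_mult_right])
    qed (fact t(1) \<tau>f)+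
    then show ?thesis
      unfolding has_field_derivative_def t(2) J_def .
  qed
  have "quadrature_on J (\<lambda>y. 1 / g y)"
    using g nz by (intro quadrature_on.divide quadrature_on.const) (auto simp: J_def)
  then have \<tau>: "quadrature_on J \<tau>"
    by (rule quadrature_on_antiderivative[OF _ J deriv_\<tau>])
  have inj_\<tau>: "inj_on \<tau> J"
    by (auto simp: inj_on_def J_def \<tau>f)
  have "quadrature_on {a..b} (inv_into J \<tau>)"
    using quadrature_on.inverse[OF \<tau> J inj_\<tau>] \<tau>J by simp
  then show ?thesis
  proof (rule quadrature_on.cong, intro ballI)
    fix t assume "t \<in> {a..b}"
    then show "f t = inv_into J \<tau> t"
      using inv_into_f_f[OF inj_\<tau>, of "f t"] \<tau>f by (simp add: J_def)
  qed
qed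

section \<open>Newton equations with a polynomial energy law\<close>

lemma nonvanishing_keeps_sign:
  fixes z :: "real \<Rightarrow> real"
  assumes "continuous_on {a..b} z" "\<And>t. t \<in> {a..b} \<Longrightarrow> z t \<noteq> 0"
  shows "(\<forall>t\<in>{a..b}. z t > 0) \<or> (\<forall>t\<in>{a..b}. z t < 0)"
proof (rule ccontr)
  assume "\<not> ?thesis"
  then obtain s t where st: "s \<in> {a..b}" "t \<in> {a..b}" "z s < 0" "0 < z t"
    using assms(2) by (metis linorder_neqE_linordered_idom)
  have "is_interval (z ` {a..b})"
    unfolding is_interval_connected_1 by (intro connected_continuous_image assms(1)) simp
  then have "0 \<in> z ` {a..b}"
    using st unfolding is_interval_1 by (meson image_eqI less_imp_le)
  then show False
    using assms(2) by force
qed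

lemma quadrature_on_newton_moving:
  assumes y: "\<And>t. t \<in> {a..b} \<Longrightarrow> (y has_real_derivative z t) (at t within {a..b})"
    and z: "continuous_on {a..b} z"
    and energy: "\<And>t. t \<in> {a..b} \<Longrightarrow> (z t)\<^sup>2 = poly p (y t)"
    and nz: "\<And>t. t \<in> {a..b} \<Longrightarrow> z t \<noteq> 0"
  shows "quadrature_on {a..b} y"
proof -
  obtain \<sigma> :: real where z_eq: "\<And>t. t \<in> {a..b} \<Longrightarrow> z t = \<sigma> * \<bar>z t\<bar>"
  proof (cases "\<forall>t\<in>{a..b}. z t > 0")
    case True
    then show ?thesis by (intro that[of 1]) force+
  next
    case False
    then have "\<forall>t\<in>{a..b}. z t < 0"
      using nonvanishing_keeps_sign[OF z nz] by blast
    then show ?thesis by (intro that[of "-1"]) force+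
  qed
  define g where "g x = \<sigma> * root 2 (poly p x)" for x
  have g_y: "g (y t) = z t" if "t \<in> {a..b}" for t
    using z_eq[OF that] by (simp add: g_def flip: energy[OF that] sqrt_def)
  show ?thesis
  proof (rule quadrature_on_autonomous)
    show "(y has_real_derivative g (y t)) (at t within {a..b})" and "g (y t) \<noteq> 0"
      if "t \<in> {a..b}" for t
      using y[OF that] nz[OF that] by (simp_all add: g_y[OF that])
    show "quadrature_on (y ` {a..b}) g"
      unfolding g_def
      by (intro quadrature_on.mult quadrature_on.const quadrature_on.root quadrature_on_poly)
        (auto simp flip: energy)
  qed
qed

text \<open>
  On a piece that may contain turning points, the position is a function of the velocity, and it
  is the velocity that moves monotonically.
\<close>

lemma quadrature_on_newton_turning:
  assumes y: "continuous_on {a..b} y"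
    and z: "\<And>t. t \<in> {a..b} \<Longrightarrow> (z has_real_derivative poly (pderiv p) (y t) / 2) (at t within {a..b})"
    and energy: "\<And>t. t \<in> {a..b} \<Longrightarrow> (z t)\<^sup>2 = poly p (y t)"
    and nz: "\<And>t. t \<in> {a..b} \<Longrightarrow> poly (pderiv p) (y t) \<noteq> 0"
  shows "quadrature_on {a..b} y"
proof -
  define J where "J = y ` {a..b}"
  define r where "r = inv_into J (poly p)"
  have J: "is_interval J"
    unfolding J_def is_interval_connected_1
    by (intro connected_continuous_image y) simp
  have inj: "inj_on (poly p) J"
  proof (rule inj_on_if_deriv_nonzero[OF J])
    show "(poly p has_real_derivative poly (pderiv p) x) (at x within J)" for x
      by (rule has_field_derivative_at_within[OF poly_DERIV])
  qed (use nz in \<open>auto simp: J_def\<close>)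
  have r: "quadrature_on (poly p ` J) r"
    unfolding r_def by (rule quadrature_on.inverse[OF quadrature_on_poly J inj])
  have y_eq: "r ((z t)\<^sup>2) = y t" if "t \<in> {a..b}" for t
    using that inj by (simp add: energy r_def J_def)
  have sq: "(z t)\<^sup>2 \<in> poly p ` J" if "t \<in> {a..b}" for t
    using that by (auto simp: energy J_def)
  have "quadrature_on (z ` {a..b}) (\<lambda>v. r (v\<^sup>2))"
    by (rule quadrature_on.subst[OF quadrature_on_power[OF quadrature_on.ident] r])
      (use sq in auto)
  then have "quadrature_on (z ` {a..b}) (\<lambda>v. poly (pderiv p) (r (v\<^sup>2)))"
    by (rule quadrature_on.subst[OF _ quadrature_on_poly[of UNIV]]) auto
  then have "quadrature_on (z ` {a..b}) (\<lambda>v. poly (pderiv p) (r (v\<^sup>2)) / 2)"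
    by (intro quadrature_on.divide quadrature_on.const) auto
  then have "quadrature_on {a..b} z"
    by (rule quadrature_on_autonomous[rotated]) (simp_all add: y_eq z nz)
  then have "quadrature_on {a..b} (\<lambda>t. r ((z t)\<^sup>2))"
    by (intro quadrature_on.subst[OF quadrature_on_power r]) (use sq in auto)
  then show ?thesis
    by (rule quadrature_on.cong) (simp add: y_eq)
qed

text \<open>
  Gronwall's inequality in both time directions: \<open>N * exp (- K * t)\<close> decreases and
  \<open>N * exp (K * t)\<close> increases.
\<close>

lemma gronwall_zero:
  fixes N :: "real \<Rightarrow> real"
  assumes N: "\<And>t. t \<in> {a..b} \<Longrightarrow> (N has_real_derivative N' t) (at t within {a..b})"
    and bound: "\<And>t. t \<in> {a..b} \<Longrightarrow> \<bar>N' t\<bar> \<le> K * N t"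
    and nonneg: "\<And>t. t \<in> {a..b} \<Longrightarrow> 0 \<le> N t"
    and c: "c \<in> {a..b}" "N c = 0" and t: "t \<in> {a..b}"
  shows "N t = 0"
proof -
  have cont: "continuous_on {a..b} N"
    using N by (meson DERIV_continuous continuous_on_eq_continuous_within)
  have D: "(N has_real_derivative N' s) (at s)" if "a < s" "s < b" for s
    using N[of s] at_within_Icc_at[of a s b] that by simp
  have "N t \<le> 0"
  proof (cases "c \<le> t")
    case True
    have "N t * exp (- K * t) \<le> N c * exp (- K * c)"
    proof (rule DERIV_nonpos_imp_decreasing_open[OF True])
      fix s assume s: "c < s" "s < t"
      then have ab: "s \<in> {a..b}" using c t by auto
      have "((\<lambda>s. N s * exp (- K * s)) has_real_derivative (N' s - K * N s) * exp (- K * s)) (at s)"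
        by (rule derivative_eq_intros D refl | use s c t in \<open>force simp: algebra_simps\<close>)+
      moreover have "(N' s - K * N s) * exp (- K * s) \<le> 0"
        using bound[OF ab] by (intro mult_nonpos_nonneg) auto
      ultimately show "\<exists>d. ((\<lambda>s. N s * exp (- K * s)) has_real_derivative d) (at s) \<and> d \<le> 0"
        by blast
    next
      show "continuous_on {c..t} (\<lambda>s. N s * exp (- K * s))"
        using c t by (intro continuous_intros continuous_on_subset[OF cont]) auto
    qed
    then show ?thesis
      by (simp add: c mult_le_0_iff)
  next
    case False
    then have "t \<le> c" by simp
    then have "N t * exp (K * t) \<le> N c * exp (K * c)"
    proof (rule DERIV_nonneg_imp_increasing_open)
      fix s assume s: "t < s" "s < c"
      then have ab: "s \<in> {a..b}" using c t by auto
      have "((\<lambda>s. N s * exp (K * s)) has_real_derivative (N' s + K * N s) * exp (K * s)) (at s)"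
        by (rule derivative_eq_intros D refl | use s c t in \<open>force simp: algebra_simps\<close>)+
      moreover have "(N' s + K * N s) * exp (K * s) \<ge> 0"
        using bound[OF ab] by (intro mult_nonneg_nonneg) auto
      ultimately show "\<exists>d. ((\<lambda>s. N s * exp (K * s)) has_real_derivative d) (at s) \<and> 0 \<le> d"
        by blast
    next
      show "continuous_on {t..c} (\<lambda>s. N s * exp (K * s))"
        using c t by (intro continuous_intros continuous_on_subset[OF cont]) auto
    qed
    then show ?thesis
      by (simp add: c mult_le_0_iff)
  qed
  then show ?thesis
    using nonneg[OF t] by simp
qed

text \<open>
  The force vanishes at the equilibrium \<open>y c\<close>, so it is \<open>y - y c\<close> times a polynomial that is
  bounded along the trajectory; hence \<open>(y - y c)\<^sup>2 + z\<^sup>2\<close> satisfies Gronwall's inequality.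
\<close>

lemma newton_equilibrium:
  assumes y: "\<And>t. t \<in> {a..b} \<Longrightarrow> (y has_real_derivative z t) (at t within {a..b})"
    and z: "\<And>t. t \<in> {a..b} \<Longrightarrow> (z has_real_derivative poly q (y t)) (at t within {a..b})"
    and c: "c \<in> {a..b}" "z c = 0" "poly q (y c) = 0" and t: "t \<in> {a..b}"
  shows "y t = y c"
proof -
  obtain q' where q': "q = [:- y c, 1:] * q'"
    using c(3) by (auto simp: poly_eq_0_iff_dvd dvd_def)
  have cont: "continuous_on {a..b} (\<lambda>t. poly q' (y t))"
    by (intro continuous_on_poly continuous_on_eq_continuous_within[THEN iffD2] ballI
        DERIV_continuous[OF y])
  then have "bounded ((\<lambda>t. poly q' (y t)) ` {a..b})"
    by (intro compact_imp_bounded compact_continuous_image compact_Icc)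
  then obtain L where L: "\<And>s. s \<in> {a..b} \<Longrightarrow> \<bar>poly q' (y s)\<bar> \<le> L"
    by (metis bounded_real image_eqI)
  define N where "N s = (y s - y c)\<^sup>2 + (z s)\<^sup>2" for s
  have "N t = 0"
  proof (rule gronwall_zero[where N = N and a = a and b = b and K = "1 + L" and c = c and
          N' = "\<lambda>s. 2 * ((y s - y c) * z s) * (1 + poly q' (y s))"])
    fix s assume s: "s \<in> {a..b}"
    show "(N has_real_derivative 2 * ((y s - y c) * z s) * (1 + poly q' (y s))) (at s within {a..b})"
      unfolding N_def[abs_def]
      by (rule derivative_eq_intros y[OF s] z[OF s] refl | simp add: q' algebra_simps)+
    have "2 * \<bar>(y s - y c) * z s\<bar> \<le> N s"
      using sum_squares_bound[of "\<bar>y s - y c\<bar>" "\<bar>z s\<bar>"] by (simp add: N_def abs_mult mult.assoc)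
    moreover have "\<bar>1 + poly q' (y s)\<bar> \<le> 1 + L"
      using L[OF s] by linarith
    ultimately have "(2 * \<bar>(y s - y c) * z s\<bar>) * \<bar>1 + poly q' (y s)\<bar> \<le> N s * (1 + L)"
      by (intro mult_mono) (auto simp: N_def)
    then show "\<bar>2 * ((y s - y c) * z s) * (1 + poly q' (y s))\<bar> \<le> (1 + L) * N s"
      by (simp add: abs_mult mult.commute)
    show "0 \<le> N s"
      by (simp add: N_def)
  qed (use c t in \<open>auto simp: N_def\<close>)
  then show ?thesis
    by (simp add: N_def add_nonneg_eq_0_iff)
qed

lemma continuous_on_Icc_nonvanishing_near:
  fixes f :: "real \<Rightarrow> real"
  assumes "continuous_on {a..b} f" "x \<in> {a..b}" "f x \<noteq> 0"
  obtains d where "d > 0" "\<And>t. t \<in> {a..b} \<Longrightarrow> \<bar>t - x\<bar> < d \<Longrightarrow> f t \<noteq> 0"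
proof -
  obtain d where "d > 0" and d: "\<And>t. t \<in> {a..b} \<Longrightarrow> dist t x < d \<Longrightarrow> dist (f t) (f x) < \<bar>f x\<bar>"
    using assms unfolding continuous_on_iff by (metis zero_less_abs_iff)
  then show ?thesis
    by (intro that[of d]) (force simp: dist_real_def)+
qed

theorem quadrature_on_newton:
  assumes ab: "a \<le> b"
    and y: "\<And>t. t \<in> {a..b} \<Longrightarrow> (y has_real_derivative z t) (at t within {a..b})"
    and z: "\<And>t. t \<in> {a..b} \<Longrightarrow> (z has_real_derivative poly (pderiv p) (y t) / 2) (at t within {a..b})"
    and energy: "\<And>t. t \<in> {a..b} \<Longrightarrow> (z t)\<^sup>2 = poly p (y t)"
  shows "quadrature_on {a..b} y"
proof (cases "\<exists>c\<in>{a..b}. z c = 0 \<and> poly (pderiv p) (y c) = 0")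
  case True
  then obtain c where c: "c \<in> {a..b}" "z c = 0" "poly (pderiv p) (y c) = 0"
    by blast
  have "y t = y c" if "t \<in> {a..b}" for t
    by (rule newton_equilibrium[where q = "smult (1/2) (pderiv p)", OF y _ c(1,2) _ that])
      (use z c in auto)
  then show ?thesis
    by (intro quadrature_on.cong[OF quadrature_on.const[of _ "y c"]]) auto
next
  case False
  have cont_y: "continuous_on {a..b} y" and cont_z: "continuous_on {a..b} z"
    using y z by (meson DERIV_continuous continuous_on_eq_continuous_within)+
  have cont_force: "continuous_on {a..b} (\<lambda>t. poly (pderiv p) (y t))"
    by (intro continuous_on_poly cont_y)
  define good where "good s t \<longleftrightarrow> ({s..t} \<subseteq> {a..b} \<longrightarrow> quadrature_on {s..t} y)" for s t
  from ab have "good a b"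
  proof (induction rule: Bolzano)
    case (trans r s t)
    then show ?case
      using quadrature_on_glue[of r s y t] by (auto simp: good_def)
  next
    case (local x)
    then have x: "x \<in> {a..b}" by simp
    have y': "(y has_real_derivative z t) (at t within S)"
      and z': "(z has_real_derivative poly (pderiv p) (y t) / 2) (at t within S)"
      if "S \<subseteq> {a..b}" "t \<in> S" for S t
      using that y z by (meson has_field_derivative_subset subsetD)+
    consider "z x \<noteq> 0" | "poly (pderiv p) (y x) \<noteq> 0"
      using False x by blast
    then show ?case
    proof cases
      case 1
      then obtain d where d: "d > 0" "\<And>t. t \<in> {a..b} \<Longrightarrow> \<bar>t - x\<bar> < d \<Longrightarrow> z t \<noteq> 0"
        using continuous_on_Icc_nonvanishing_near[OF cont_z x] by metis
      have "good r s" if "r \<le> x \<and> x \<le> s \<and> s - r < d" for r s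
        unfolding good_def
      proof
        assume sub: "{r..s} \<subseteq> {a..b}"
        have nz: "z t \<noteq> 0" if "t \<in> {r..s}" for t
          using that \<open>r \<le> x \<and> x \<le> s \<and> s - r < d\<close> sub by (intro d(2)) auto
        show "quadrature_on {r..s} y"
          by (rule quadrature_on_newton_moving[where z = z and p = p])
            (use sub y' energy continuous_on_subset[OF cont_z] nz in auto)
      qed
      with d(1) show ?thesis by blast
    next
      case 2
      then obtain d where d: "d > 0"
        "\<And>t. t \<in> {a..b} \<Longrightarrow> \<bar>t - x\<bar> < d \<Longrightarrow> poly (pderiv p) (y t) \<noteq> 0"
        using continuous_on_Icc_nonvanishing_near[OF cont_force x] by metis
      have "good r s" if "r \<le> x \<and> x \<le> s \<and> s - r < d" for r s
        unfolding good_def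
      proof
        assume sub: "{r..s} \<subseteq> {a..b}"
        have nz: "poly (pderiv p) (y t) \<noteq> 0" if "t \<in> {r..s}" for t
          using that \<open>r \<le> x \<and> x \<le> s \<and> s - r < d\<close> sub by (intro d(2)) auto
        show "quadrature_on {r..s} y"
          by (rule quadrature_on_newton_turning[where z = z and p = p])
            (use sub z' energy continuous_on_subset[OF cont_y] nz in auto)
      qed
      with d(1) show ?thesis by blast
    qed
  qed
  then show ?thesis
    by (simp add: good_def)
qed

section \<open>The pendulum\<close>

lemma constant_on_Icc_if_deriv_zero:
  fixes f :: "real \<Rightarrow> real"
  assumes "\<And>t. t \<in> {a..b} \<Longrightarrow> (f has_real_derivative 0) (at t within {a..b})"
  obtains C where "\<And>t. t \<in> {a..b} \<Longrightarrow> f t = C"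
proof -
  have "\<exists>C. \<forall>t\<in>{a..b}. f t = C"
    by (rule has_field_derivative_zero_constant) (use assms in auto)
  then show ?thesis
    using that by blast
qed

text \<open>
  With \<open>u = a * h2 - b * h1\<close> and \<open>v = a * h1 + b * h2\<close> the system reads \<open>u' = h3 * v\<close>,
  \<open>v' = - h3 * u\<close>, \<open>h3' = v\<close>.  The integrals \<open>E = h3\<^sup>2 / 2 - u\<close> and \<open>R = u\<^sup>2 + v\<^sup>2\<close> give
  \<open>h3'\<^sup>2 = R - (h3\<^sup>2 / 2 - E)\<^sup>2\<close>.  For \<open>(a, b) \<noteq> (0, 0)\<close> the pair \<open>(h1, h2)\<close> is recovered linearly
  from \<open>u\<close> and \<open>v\<close>.  For \<open>a = b = 0\<close> the angular velocity \<open>h3\<close> is constant and \<open>h1\<close> is a harmonic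
  oscillation.
\<close>

lemma quadrature_on_pendulum:
  fixes T :: real
  assumes T: "0 \<le> T"
    and h1: "\<And>t. t \<in> {0..T} \<Longrightarrow> (h1 has_real_derivative - h2 t * h3 t) (at t within {0..T})"
    and h2: "\<And>t. t \<in> {0..T} \<Longrightarrow> (h2 has_real_derivative h1 t * h3 t) (at t within {0..T})"
    and h3: "\<And>t. t \<in> {0..T} \<Longrightarrow> (h3 has_real_derivative a * h1 t + b * h2 t) (at t within {0..T})"
  shows "quadrature_on {0..T} h1" "quadrature_on {0..T} h2"
proof -
  have "quadrature_on {0..T} h1 \<and> quadrature_on {0..T} h2"
  proof (cases "a = 0 \<and> b = 0")
    case True
    then obtain w where w: "\<And>t. t \<in> {0..T} \<Longrightarrow> h3 t = w"
      using h3 constant_on_Icc_if_deriv_zero[of 0 T h3] by auto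
    have "((\<lambda>s. (h1 s)\<^sup>2 + (h2 s)\<^sup>2) has_real_derivative 0) (at t within {0..T})"
      if t: "t \<in> {0..T}" for t
      by (rule derivative_eq_intros h1[OF t] h2[OF t] refl | simp add: algebra_simps)+
    then obtain R where R: "\<And>t. t \<in> {0..T} \<Longrightarrow> (h1 t)\<^sup>2 + (h2 t)\<^sup>2 = R"
      using constant_on_Icc_if_deriv_zero[of 0 T "\<lambda>s. (h1 s)\<^sup>2 + (h2 s)\<^sup>2"] by auto
    have q1: "quadrature_on {0..T} h1"
    proof (rule quadrature_on_newton[OF T])
      fix t assume t: "t \<in> {0..T}"
      show "(h1 has_real_derivative - w * h2 t) (at t within {0..T})"
        using h1[OF t] w[OF t] by (simp add: mult.commute)
      show "((\<lambda>t. - w * h2 t) has_real_derivative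
          poly (pderiv [:w\<^sup>2 * R, 0, - w\<^sup>2:]) (h1 t) / 2) (at t within {0..T})"
        by (rule derivative_eq_intros h2[OF t] refl
            | simp add: w[OF t] pderiv_pCons power2_eq_square algebra_simps)+
      show "(- w * h2 t)\<^sup>2 = poly [:w\<^sup>2 * R, 0, - w\<^sup>2:] (h1 t)"
        by (simp add: R[OF t, symmetric] power2_eq_square algebra_simps)
    qed
    have "quadrature_on {0..T} h2"
    proof (rule quadrature_on_antiderivative)
      show "quadrature_on {0..T} (\<lambda>t. h1 t * w)"
        by (intro quadrature_on.mult q1 quadrature_on.const)
    qed (use h2 w in \<open>auto simp: is_interval_cc\<close>)
    with q1 show ?thesis by blast
  next
    case False
    then have nz: "a\<^sup>2 + b\<^sup>2 \<noteq> 0"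
      by (simp add: sum_power2_eq_zero_iff)
    define u where "u t = a * h2 t - b * h1 t" for t
    define v where "v t = a * h1 t + b * h2 t" for t
    have u: "(u has_real_derivative h3 t * v t) (at t within {0..T})"
      and v: "(v has_real_derivative - h3 t * u t) (at t within {0..T})"
      and h3': "(h3 has_real_derivative v t) (at t within {0..T})"
      if t: "t \<in> {0..T}" for t
      unfolding u_def[abs_def] v_def[abs_def]
      by (rule derivative_eq_intros h1[OF t] h2[OF t] h3[OF t] refl | simp add: algebra_simps)+
    have "((\<lambda>s. (h3 s)\<^sup>2 / 2 - u s) has_real_derivative 0) (at t within {0..T})"
      if t: "t \<in> {0..T}" for t
      by (rule derivative_eq_intros u[OF t] h3'[OF t] refl | simp)+
    then obtain E where E: "\<And>t. t \<in> {0..T} \<Longrightarrow> (h3 t)\<^sup>2 / 2 - u t = E"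
      using constant_on_Icc_if_deriv_zero[of 0 T "\<lambda>s. (h3 s)\<^sup>2 / 2 - u s"] by auto
    have "((\<lambda>s. (u s)\<^sup>2 + (v s)\<^sup>2) has_real_derivative 0) (at t within {0..T})"
      if t: "t \<in> {0..T}" for t
      by (rule derivative_eq_intros u[OF t] v[OF t] refl | simp add: algebra_simps)+
    then obtain R where R: "\<And>t. t \<in> {0..T} \<Longrightarrow> (u t)\<^sup>2 + (v t)\<^sup>2 = R"
      using constant_on_Icc_if_deriv_zero[of 0 T "\<lambda>s. (u s)\<^sup>2 + (v s)\<^sup>2"] by auto
    have u_eq: "u t = (h3 t)\<^sup>2 / 2 - E" if "t \<in> {0..T}" for t
      using E[OF that] by simp
    \<comment> \<open>the quartic \<open>R - (w\<^sup>2 / 2 - E)\<^sup>2\<close>\<close>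
    define p where "p = [:R - E\<^sup>2, 0, E, 0, - 1 / 4:]"
    have q3: "quadrature_on {0..T} h3"
    proof (rule quadrature_on_newton[OF T h3'])
      fix t assume t: "t \<in> {0..T}"
      have "poly (pderiv p) (h3 t) / 2 = - h3 t * u t"
        by (simp add: p_def pderiv_pCons u_eq[OF t] power2_eq_square field_simps)
      then show "(v has_real_derivative poly (pderiv p) (h3 t) / 2) (at t within {0..T})"
        using v[OF t] by simp
      have "(v t)\<^sup>2 = R - (u t)\<^sup>2"
        using R[OF t] by simp
      then show "(v t)\<^sup>2 = poly p (h3 t)"
        by (simp add: p_def u_eq[OF t] power2_eq_square algebra_simps)
    qed
    have qu: "quadrature_on {0..T} u"
    proof (rule quadrature_on.cong)
      show "quadrature_on {0..T} (\<lambda>t. (h3 t)\<^sup>2 / 2 - E)"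
        by (intro quadrature_on.diff quadrature_on.divide quadrature_on_power q3
            quadrature_on.const) simp
    qed (use u_eq in auto)
    have qv: "quadrature_on {0..T} v"
      by (rule quadrature_on_antiderivative[OF _ _ v])
        (auto intro!: quadrature_on.mult quadrature_on_uminus q3 qu simp: is_interval_cc)
    have "quadrature_on {0..T} (\<lambda>t. (a * v t - b * u t) / (a\<^sup>2 + b\<^sup>2))"
      by (intro quadrature_on.divide quadrature_on.diff quadrature_on.mult quadrature_on.const
          qu qv ballI nz)
    moreover have "h1 t = (a * v t - b * u t) / (a\<^sup>2 + b\<^sup>2)" for t
      using nz by (simp add: u_def v_def eq_divide_eq) (simp add: power2_eq_square algebra_simps)
    moreover have "quadrature_on {0..T} (\<lambda>t. (a * u t + b * v t) / (a\<^sup>2 + b\<^sup>2))"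
      by (intro quadrature_on.divide quadrature_on.add quadrature_on.mult quadrature_on.const
          qu qv ballI nz)
    moreover have "h2 t = (a * u t + b * v t) / (a\<^sup>2 + b\<^sup>2)" for t
      using nz by (simp add: u_def v_def eq_divide_eq) (simp add: power2_eq_square algebra_simps)
    ultimately show ?thesis
      using quadrature_on.cong by blast
  qed
  then show "quadrature_on {0..T} h1" "quadrature_on {0..T} h2"
    by auto
qed

section \<open>The Hamiltonian system\<close>

definition momentum2 :: "nat \<Rightarrow> nat \<Rightarrow> point \<Rightarrow> point \<Rightarrow> real" where
  "momentum2 \<alpha> \<beta> x \<psi> =
     \<psi> 2 + x 1 * \<psi> 3 + real \<alpha> / 2 * (x 1)\<^sup>2 * \<psi> 4 + real \<beta> * x 1 * x 2 * \<psi> 5"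

lemma deriv_true_hamiltonian_momentum:
  assumes "(\<alpha>, \<beta>) \<in> {(0, 0), (1, 0), (1, 1)}"
  shows "deriv (\<lambda>p. true_hamiltonian (sub_riemannian_problem \<alpha> \<beta> T) x (\<psi>(i := p))) (\<psi> i) =
    \<psi> 1 * X1 x i + momentum2 \<alpha> \<beta> x \<psi> * X2 \<alpha> \<beta> x i"
proof -
  have D: "((\<lambda>p. (\<psi>(i := p)) k) has_real_derivative of_bool (k = i)) (at q)" for k q
    by (cases "k = i") auto
  show ?thesis
    unfolding true_hamiltonian_sub_riemannian[OF assms]
    by (rule DERIV_imp_deriv, (rule derivative_eq_intros D refl)+)
      (auto simp: X1_def X2_def momentum2_def algebra_simps)
qed

lemma deriv_true_hamiltonian_position:
  assumes "(\<alpha>, \<beta>) \<in> {(0, 0), (1, 0), (1, 1)}"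
  shows "deriv (\<lambda>y. true_hamiltonian (sub_riemannian_problem \<alpha> \<beta> T) (x(i := y)) \<psi>) (x i) =
    momentum2 \<alpha> \<beta> x \<psi> *
      (if i = 1 then \<psi> 3 + real \<alpha> * x 1 * \<psi> 4 + real \<beta> * x 2 * \<psi> 5
       else if i = 2 then real \<beta> * x 1 * \<psi> 5 else 0)"
proof -
  have D: "((\<lambda>y. (x(i := y)) k) has_real_derivative of_bool (k = i)) (at q)" for k q
    by (cases "k = i") auto
  show ?thesis
    unfolding true_hamiltonian_sub_riemannian[OF assms]
    by (rule DERIV_imp_deriv, (rule derivative_eq_intros D refl)+)
      (auto simp: momentum2_def algebra_simps power2_eq_square)
qed

theorem lemma2:
  fixes \<alpha> \<beta> :: nat and T :: real
  assumes "(\<alpha>, \<beta>) \<in> {(0, 0), (1, 0), (1, 1)}"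
    and "T > 0"
  shows "integrable_by_quadratures (sub_riemannian_problem \<alpha> \<beta> T)"
  unfolding integrable_by_quadratures_def
proof (intro allI impI)
  fix x \<psi> :: "real \<Rightarrow> point"
  let ?P = "sub_riemannian_problem \<alpha> \<beta> T"
  assume "hamiltonian_solution ?P x \<psi>"
  note solution = this[unfolded hamiltonian_solution_def deriv_true_hamiltonian_momentum[OF assms(1)]
      deriv_true_hamiltonian_position[OF assms(1)]]
  have dim [simp]: "dimension ?P = 3 + \<alpha> + \<beta>" and hor [simp]: "horizon ?P = T"
    by (simp_all add: sub_riemannian_problem_def)
  define h1 where "h1 t = \<psi> t 1" for t
  define h2 where "h2 t = momentum2 \<alpha> \<beta> (x t) (\<psi> t)" for t
  define h3 where "h3 t = \<psi> t 3 + real \<alpha> * x t 1 * \<psi> t 4 + real \<beta> * x t 2 * \<psi> t 5" for t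
  have x: "((\<lambda>s. x s i) has_real_derivative h1 t * X1 (x t) i + h2 t * X2 \<alpha> \<beta> (x t) i)
      (at t within {0..T})"
    and \<psi>: "((\<lambda>s. \<psi> s i) has_real_derivative
        - (h2 t * (if i = 1 then h3 t else if i = 2 then real \<beta> * x t 1 * \<psi> t 5 else 0)))
      (at t within {0..T})"
    if "i \<in> {1..3 + \<alpha> + \<beta>}" "t \<in> {0..T}" for i t
    unfolding h1_def h2_def h3_def
    using solution[unfolded hor dim, THEN bspec, THEN bspec, OF that(2,1)] by (rule conjunct1, rule conjunct2)
  \<comment> \<open>In dimension 3 and 4 the components with indices 4 and 5 are arbitrary functions, but they only
    enter multiplied by \<open>\<alpha> = 0\<close> or \<open>\<beta> = 0\<close>.\<close>
  have "((\<lambda>s. real \<alpha> * \<psi> s 4) has_real_derivative 0) (at t within {0..T})"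
    if t: "t \<in> {0..T}" for t
    using DERIV_cmult[OF \<psi>[OF _ t, of 4], of "real \<alpha>"] by (cases "\<alpha> = 0") auto
  then obtain a where a: "\<And>t. t \<in> {0..T} \<Longrightarrow> real \<alpha> * \<psi> t 4 = a"
    using constant_on_Icc_if_deriv_zero[of 0 T "\<lambda>s. real \<alpha> * \<psi> s 4"] by auto
  have "((\<lambda>s. real \<beta> * \<psi> s 5) has_real_derivative 0) (at t within {0..T})"
    if t: "t \<in> {0..T}" for t
    using DERIV_cmult[OF \<psi>[OF _ t, of 5], of "real \<beta>"] assms(1) by (cases "\<beta> = 0") auto
  then obtain b where b: "\<And>t. t \<in> {0..T} \<Longrightarrow> real \<beta> * \<psi> t 5 = b"
    using constant_on_Icc_if_deriv_zero[of 0 T "\<lambda>s. real \<beta> * \<psi> s 5"] by auto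
  have h2_eq: "h2 t = \<psi> t 2 + x t 1 * \<psi> t 3 + a / 2 * (x t 1)\<^sup>2 + b * x t 1 * x t 2"
    and h3_eq: "h3 t = \<psi> t 3 + a * x t 1 + b * x t 2" if "t \<in> {0..T}" for t
    by (simp_all add: h2_def h3_def momentum2_def algebra_simps flip: a[OF that] b[OF that])
  have x1: "((\<lambda>s. x s 1) has_real_derivative h1 t) (at t within {0..T})"
    and x2: "((\<lambda>s. x s 2) has_real_derivative h2 t) (at t within {0..T})"
    and \<psi>1: "(h1 has_real_derivative - h2 t * h3 t) (at t within {0..T})"
    and \<psi>2: "((\<lambda>s. \<psi> s 2) has_real_derivative - h2 t * (b * x t 1)) (at t within {0..T})"
    and \<psi>3: "((\<lambda>s. \<psi> s 3) has_real_derivative 0) (at t within {0..T})"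
    if t: "t \<in> {0..T}" for t
    using x[OF _ t, of 1] x[OF _ t, of 2] \<psi>[OF _ t, of 1] \<psi>[OF _ t, of 2] \<psi>[OF _ t, of 3]
    by (simp_all add: X1_def X2_def h1_def[abs_def] algebra_simps flip: b[OF t])
  have h2_deriv: "(h2 has_real_derivative h1 t * h3 t) (at t within {0..T})" if t: "t \<in> {0..T}" for t
  proof (rule has_field_derivative_transform_within[where d = 1])
    show "((\<lambda>s. \<psi> s 2 + x s 1 * \<psi> s 3 + a / 2 * (x s 1)\<^sup>2 + b * x s 1 * x s 2)
        has_real_derivative h1 t * h3 t) (at t within {0..T})"
      by (rule derivative_eq_intros x1[OF t] x2[OF t] \<psi>2[OF t] \<psi>3[OF t] refl
          | simp add: h3_eq[OF t] algebra_simps)+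
  qed (use t h2_eq in auto)
  have h3_deriv: "(h3 has_real_derivative a * h1 t + b * h2 t) (at t within {0..T})"
    if t: "t \<in> {0..T}" for t
  proof (rule has_field_derivative_transform_within[where d = 1])
    show "((\<lambda>s. \<psi> s 3 + a * x s 1 + b * x s 2)
        has_real_derivative a * h1 t + b * h2 t) (at t within {0..T})"
      by (rule derivative_eq_intros x1[OF t] x2[OF t] \<psi>3[OF t] refl | simp)+
  qed (use t h3_eq in auto)
  have q1: "quadrature_on {0..T} h1" and q2: "quadrature_on {0..T} h2"
    using quadrature_on_pendulum[OF _ \<psi>1 h2_deriv h3_deriv] assms(2) by auto
  note antiderivative = quadrature_on_antiderivative[OF _ is_interval_cc]
  have qx1: "quadrature_on {0..T} (\<lambda>t. x t 1)"
    by (rule antiderivative[OF q1 x1])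
  have qx2: "quadrature_on {0..T} (\<lambda>t. x t 2)"
    by (rule antiderivative[OF q2 x2])
  show "\<forall>i\<in>{1..dimension ?P}. quadrature_on {0..horizon ?P} (\<lambda>t. x t i) \<and>
      quadrature_on {0..horizon ?P} (\<lambda>t. \<psi> t i)"
  proof
    fix i assume "i \<in> {1..dimension ?P}"
    then have i: "i \<in> {1..3 + \<alpha> + \<beta>}" by simp
    have "quadrature_on {0..T} (\<lambda>t. X2 \<alpha> \<beta> (x t) i)"
      unfolding X2_def power2_eq_square
      by (cases "i = 2"; cases "i = 3"; cases "i = 4"; cases "i = 5")
        (auto intro!: quadrature_on.mult quadrature_on.divide quadrature_on.const qx1 qx2
          simp flip: One_nat_def)
    moreover have "quadrature_on {0..T} (\<lambda>t. X1 (x t) i)"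
      unfolding X1_def by (rule quadrature_on.const)
    ultimately have "quadrature_on {0..T} (\<lambda>t. x t i)"
      by (intro antiderivative[OF _ x[OF i]] quadrature_on.add quadrature_on.mult q1 q2)
    moreover consider "i = 1" | "i = 2" | "i > 2"
      using i by force
    then have "quadrature_on {0..T} (\<lambda>t. \<psi> t i)"
    proof cases
      case 1
      then show ?thesis using q1 by (simp add: h1_def[abs_def])
    next
      case 2
      have "quadrature_on {0..T} (\<lambda>t. - h2 t * (b * x t 1))"
        by (intro quadrature_on.mult quadrature_on_uminus quadrature_on.const q2 qx1)
      with 2 show ?thesis using antiderivative[OF _ \<psi>2] by simp
    next
      case 3
      then show ?thesis
        using \<psi>[OF i] by (intro antiderivative[OF quadrature_on.const[of _ 0]]) auto
    qed
    ultimately show "quadrature_on {0..horizon ?P} (\<lambda>t. x t i) \<and>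
        quadrature_on {0..horizon ?P} (\<lambda>t. \<psi> t i)"
      by simp
  qed
qed

end
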